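(* Let $\kappa>0$, $K_*>0$, $T_*>0$ and let $V:\mathbf{R}\to\mathbf{R}$ be smooth with $V(0)=V'(0)=0$ and $V''(0)=:k>0$. Then there exist $\rho_*=\rho_*(V)>0$ (depending only on $V$), $\mu_*=\mu_*(K_*,T_*,\kappa,V)>0$ and $C_*=C_*(K_*,T_*,\kappa,V)>0$ for which the following holds when $\mu\in(0,\mu_*]$. Suppose that $(\tilde R,\tilde P)$ solves the FPUT system $$\dot{\tilde R}=\delta^+\tilde P,\qquad \dot{\tilde P}=\delta^-[V'(\tilde R)]$$ with $$\|\tilde R(0)\|+\|\tilde P(0)\|\le\rho_*,$$ and that $(R,P,r,p)$ solves the mass-in-mass lattice $$\dot R=\delta^+P,\qquad \dot P=\delta^-[V'(R)]+\kappa r,\qquad \dot r=p-P,\qquad \mu\dot p=-\kappa r$$ with $$\|(R(0),P(0),r(0),p(0))-(\tilde R(0),\tilde P(0),0,\tilde P(0))\|_\mu\le K_*\sqrt{\mu}.$$ Then $$\|(R(t),P(t),r(t),p(t))-(\tilde R(t),\tilde P(t),0,\tilde P(t))\|_\mu\le C_*\sqrt{\mu}$$ for all $t\in[-T_*,T_*]$.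
   Context: "Smooth" means $C^\infty$. All unknowns are functions of time $t$ with values in real sequences indexed by $j\in\mathbf{Z}$; the lattice index is suppressed. $\ell^2=\ell^2(\mathbf{Z})$ and $\|\cdot\|:=\|\cdot\|_{\ell^2}$. The mass-in-mass system is viewed as an ODE on the Hilbert space $(\ell^2)^4$ and the FPUT system as an ODE on $(\ell^2)^2$; initial data and solutions are in these spaces. For a sequence $q$, $(\delta^{\pm}q)_j:=\pm(q_{j\pm1}-q_j)$, and $V'(R)$ denotes the sequence with entries $V'(R_j)$. Dots are time derivatives. The norm $\|\cdot\|_\mu$ on $(\ell^2)^4$ is $$\|(R,P,r,p)\|_\mu:=\sqrt{\tfrac{k}{2}\|R\|^2+\tfrac12\|P\|^2+\tfrac{\kappa}{2}\|r\|^2+\tfrac{\mu}{2}\|p\|^2},$$ where $k=V''(0)$. *)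

theory Defs
  imports "HOL-Analysis.Analysis"
begin

section \<open>The Hilbert space of square-summable bi-infinite real sequences\<close>

definition square_summable :: "(int \<Rightarrow> real) \<Rightarrow> bool" where
  "square_summable x \<longleftrightarrow> (\<lambda>j. (x j)\<^sup>2) summable_on UNIV"

lemma square_summable_0: "square_summable (\<lambda>_. 0)"
  by (simp add: square_summable_def)

lemma square_summable_cmult: "square_summable x \<Longrightarrow> square_summable (\<lambda>j. c * x j)"
  unfolding square_summable_def power_mult_distrib by (rule summable_on_cmult_right)

lemma square_summable_add:
  assumes "square_summable x" "square_summable y"
  shows "square_summable (\<lambda>j. x j + y j)"
proof -
  have "(\<lambda>j. 2 * (x j)\<^sup>2 + 2 * (y j)\<^sup>2) summable_on UNIV"
    using assms unfolding square_summable_def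
    by (intro summable_on_add summable_on_cmult_right)
  moreover have "(x j + y j)\<^sup>2 \<le> 2 * (x j)\<^sup>2 + 2 * (y j)\<^sup>2" for j
    using sum_squares_bound[of "x j" "y j"] by (simp add: power2_sum)
  ultimately show ?thesis
    unfolding square_summable_def by (rule summable_on_comparison_test) auto
qed

lemma square_summable_minus: "square_summable x \<Longrightarrow> square_summable (\<lambda>j. - x j)"
  by (simp add: square_summable_def)

lemma square_summable_diff:
  "square_summable x \<Longrightarrow> square_summable y \<Longrightarrow> square_summable (\<lambda>j. x j - y j)"
  using square_summable_add[of x "\<lambda>j. - y j"] square_summable_minus[of y] by simp

lemma square_summable_shift:
  assumes "square_summable x"
  shows "square_summable (\<lambda>j. x (j + c))"
proof -
  have "bij_betw (\<lambda>j. j + c) UNIV (UNIV :: int set)"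
    by (rule bij_betw_byWitness[where f' = "\<lambda>j. j - c"]) auto
  from summable_on_reindex_bij_betw[OF this, of "\<lambda>j. (x j)\<^sup>2"] assms show ?thesis
    by (simp add: square_summable_def)
qed

lemma square_summable_prod:
  assumes "square_summable x" "square_summable y"
  shows "(\<lambda>j. x j * y j) summable_on UNIV"
proof -
  have "(\<lambda>j. (1/2) * ((x j + y j)\<^sup>2 + (-1) * (x j)\<^sup>2 + (-1) * (y j)\<^sup>2)) summable_on UNIV"
    using square_summable_add[OF assms] assms unfolding square_summable_def
    by (intro summable_on_cmult_right summable_on_add)
  moreover have "(\<lambda>j. (1/2) * ((x j + y j)\<^sup>2 + (-1) * (x j)\<^sup>2 + (-1) * (y j)\<^sup>2)) = (\<lambda>j. x j * y j)"
    by (auto simp: power2_eq_square algebra_simps)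
  ultimately show ?thesis by simp
qed

typedef ell2 = "{x. square_summable x}" morphisms entry Abs_ell2
  using square_summable_0 by blast

setup_lifting type_definition_ell2

lemma square_summable_entry: "square_summable (entry x)"
  using entry[of x] by simp

lemma ell2_eqI: "(\<And>j. entry x j = entry y j) \<Longrightarrow> x = y"
  by (simp add: entry_inject[symmetric] fun_eq_iff)

instantiation ell2 :: real_vector
begin

lift_definition zero_ell2 :: ell2 is "\<lambda>_. 0"
  by (rule square_summable_0)

lift_definition plus_ell2 :: "ell2 \<Rightarrow> ell2 \<Rightarrow> ell2" is "\<lambda>x y j. x j + y j"
  by (rule square_summable_add)

lift_definition minus_ell2 :: "ell2 \<Rightarrow> ell2 \<Rightarrow> ell2" is "\<lambda>x y j. x j - y j"
  by (rule square_summable_diff)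

lift_definition uminus_ell2 :: "ell2 \<Rightarrow> ell2" is "\<lambda>x j. - x j"
  by (rule square_summable_minus)

lift_definition scaleR_ell2 :: "real \<Rightarrow> ell2 \<Rightarrow> ell2" is "\<lambda>c x j. c * x j"
  by (rule square_summable_cmult)

instance
  by standard (transfer; auto simp: algebra_simps)+

end

instantiation ell2 :: real_inner
begin

lift_definition inner_ell2 :: "ell2 \<Rightarrow> ell2 \<Rightarrow> real" is
  "\<lambda>x y. \<Sum>\<^sub>\<infinity>j. x j * y j" .

definition norm_ell2 :: "ell2 \<Rightarrow> real" where
  "norm_ell2 x = sqrt (inner x x)"

definition sgn_ell2 :: "ell2 \<Rightarrow> ell2" where
  "sgn_ell2 x = x /\<^sub>R norm x"

definition dist_ell2 :: "ell2 \<Rightarrow> ell2 \<Rightarrow> real" where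
  "dist_ell2 x y = norm (x - y)"

definition uniformity_ell2 :: "(ell2 \<times> ell2) filter" where
  "uniformity_ell2 = (INF e\<in>{0<..}. principal {(x, y). dist x y < e})"

definition open_ell2 :: "ell2 set \<Rightarrow> bool" where
  "open_ell2 U \<longleftrightarrow> (\<forall>x\<in>U. \<forall>\<^sub>F (x', y) in uniformity. x' = x \<longrightarrow> y \<in> U)"

instance
proof
  fix x y z :: ell2 and r :: real and U :: "ell2 set"
  show "sgn x = x /\<^sub>R norm x" by (rule sgn_ell2_def)
  show "dist x y = norm (x - y)" by (rule dist_ell2_def)
  show "uniformity = (INF e\<in>{0<..}. principal {(x :: ell2, y). dist x y < e})"
    by (rule uniformity_ell2_def)
  show "open U \<longleftrightarrow> (\<forall>x\<in>U. \<forall>\<^sub>F (x', y) in uniformity. x' = x \<longrightarrow> y \<in> U)"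
    by (rule open_ell2_def)
  show "norm x = sqrt (inner x x)" by (rule norm_ell2_def)
  show "inner x y = inner y x" by transfer (simp add: mult.commute)
  show "inner (x + y) z = inner x z + inner y z"
    by transfer (simp add: distrib_right infsum_add square_summable_prod)
  show "inner (r *\<^sub>R x) y = r * inner x y"
    by transfer (simp add: mult.assoc infsum_cmult_right')
  show "0 \<le> inner x x" by transfer (simp add: infsum_nonneg)
  show "inner x x = 0 \<longleftrightarrow> x = 0"
  proof transfer
    fix x assume x: "square_summable x"
    show "(\<Sum>\<^sub>\<infinity>j. x j * x j) = 0 \<longleftrightarrow> x = (\<lambda>_. 0)"
    proof
      assume "(\<Sum>\<^sub>\<infinity>j. x j * x j) = 0"
      then have "x j * x j = 0" for j
        using nonneg_infsum_le_0D[of "\<lambda>j. x j * x j" UNIV j] square_summable_prod[OF x x]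
        by simp
      then show "x = (\<lambda>_. 0)" by auto
    qed simp
  qed
qed

end

lemma entry_simps [simp]:
  "entry 0 j = 0" "entry (x + y) j = entry x j + entry y j"
  "entry (x - y) j = entry x j - entry y j" "entry (- x) j = - entry x j"
  "entry (c *\<^sub>R x) j = c * entry x j"
  by (transfer; simp)+

lemma norm_ell2_eq: "norm x = sqrt (\<Sum>\<^sub>\<infinity>j. (entry x j)\<^sup>2)"
  by (simp add: norm_ell2_def inner_ell2.rep_eq power2_eq_square)

lemma norm_ell2_power2: "(norm x)\<^sup>2 = (\<Sum>\<^sub>\<infinity>j. (entry x j)\<^sup>2)"
  by (simp add: norm_ell2_eq infsum_nonneg)

lemma sum_entry_le_norm:
  assumes "finite F"
  shows "(\<Sum>j\<in>F. (entry x j)\<^sup>2) \<le> (norm x)\<^sup>2"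
  unfolding norm_ell2_power2 using assms square_summable_entry[of x]
  by (intro finite_sum_le_infsum) (auto simp: square_summable_def)

lemma abs_entry_le_norm: "\<bar>entry x j\<bar> \<le> norm x"
  using sum_entry_le_norm[of "{j}" x] abs_le_square_iff[of "entry x j" "norm x"] by simp

lemma square_summableI:
  assumes "\<And>F. finite F \<Longrightarrow> (\<Sum>j\<in>F. (x j)\<^sup>2) \<le> C"
  shows "square_summable x"
  unfolding square_summable_def using assms
  by (intro nonneg_bdd_above_summable_on) (auto intro!: bdd_aboveI[where M = C])

lemma norm_ell2_leI:
  assumes "\<And>F. finite F \<Longrightarrow> (\<Sum>j\<in>F. (entry x j)\<^sup>2) \<le> C\<^sup>2" "0 \<le> C"
  shows "norm x \<le> C"
proof -
  have "(\<Sum>\<^sub>\<infinity>j. (entry x j)\<^sup>2) \<le> C\<^sup>2"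
    using square_summable_entry[of x] assms(1)
    by (intro infsum_le_finite_sums) (auto simp: square_summable_def)
  then show ?thesis
    using assms(2) by (simp add: norm_ell2_eq real_le_lsqrt infsum_nonneg)
qed

instance ell2 :: complete_space
proof
  fix X :: "nat \<Rightarrow> ell2" assume X: "Cauchy X"
  have "Cauchy (\<lambda>n. entry (X n) j)" for j
  proof (rule metric_CauchyI)
    fix e :: real assume "0 < e"
    then obtain N where N: "\<And>m n. m \<ge> N \<Longrightarrow> n \<ge> N \<Longrightarrow> dist (X m) (X n) < e"
      using X unfolding Cauchy_def by blast
    have "dist (entry (X m) j) (entry (X n) j) < e" if "m \<ge> N" "n \<ge> N" for m n
      using abs_entry_le_norm[of "X m - X n" j] N[OF that] by (simp add: dist_norm)
    then show "\<exists>N. \<forall>m\<ge>N. \<forall>n\<ge>N. dist (entry (X m) j) (entry (X n) j) < e" by blast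
  qed
  then have "\<exists>l. (\<lambda>n. entry (X n) j) \<longlonglongrightarrow> l" for j
    by (simp add: Cauchy_convergent_iff convergent_def)
  then obtain x where x: "\<And>j. (\<lambda>n. entry (X n) j) \<longlonglongrightarrow> x j" by metis
  have tail: "\<exists>N. \<forall>m\<ge>N. \<forall>F. finite F \<longrightarrow> (\<Sum>j\<in>F. (entry (X m) j - x j)\<^sup>2) \<le> e\<^sup>2"
    if "0 < e" for e :: real
  proof -
    obtain N where N: "\<And>m n. m \<ge> N \<Longrightarrow> n \<ge> N \<Longrightarrow> dist (X m) (X n) < e"
      using X \<open>0 < e\<close> unfolding Cauchy_def by blast
    have "(\<Sum>j\<in>F. (entry (X m) j - x j)\<^sup>2) \<le> e\<^sup>2" if "m \<ge> N" "finite F" for m F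
    proof (rule tendsto_upperbound)
      show "(\<lambda>n. \<Sum>j\<in>F. (entry (X m) j - entry (X n) j)\<^sup>2) \<longlonglongrightarrow> (\<Sum>j\<in>F. (entry (X m) j - x j)\<^sup>2)"
        by (intro tendsto_intros x)
      show "\<forall>\<^sub>F n in sequentially. (\<Sum>j\<in>F. (entry (X m) j - entry (X n) j)\<^sup>2) \<le> e\<^sup>2"
      proof (rule eventually_sequentiallyI)
        fix n assume "N \<le> n"
        then have "norm (X m - X n) \<le> e" using N[OF \<open>m \<ge> N\<close>, of n] by (simp add: dist_norm)
        then have "(norm (X m - X n))\<^sup>2 \<le> e\<^sup>2" by (intro power_mono) auto
        then show "(\<Sum>j\<in>F. (entry (X m) j - entry (X n) j)\<^sup>2) \<le> e\<^sup>2"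
          using sum_entry_le_norm[OF \<open>finite F\<close>, of "X m - X n"] by simp
      qed
    qed simp
    then show ?thesis by blast
  qed
  obtain N where N: "\<And>F. finite F \<Longrightarrow> (\<Sum>j\<in>F. (entry (X N) j - x j)\<^sup>2) \<le> 1\<^sup>2"
    using tail[of 1] by auto
  have "square_summable (\<lambda>j. entry (X N) j - x j)" using N by (rule square_summableI)
  then have "square_summable x"
    using square_summable_diff[OF square_summable_entry[of "X N"], of "\<lambda>j. entry (X N) j - x j"]
    by simp
  then have entry_x: "entry (Abs_ell2 x) = x" by (simp add: Abs_ell2_inverse)
  have "X \<longlonglongrightarrow> Abs_ell2 x"
  proof (rule metric_LIMSEQ_I)
    fix e :: real assume e: "0 < e"
    then obtain N where N: "\<forall>m\<ge>N. \<forall>F. finite F \<longrightarrow> (\<Sum>j\<in>F. (entry (X m) j - x j)\<^sup>2) \<le> (e/2)\<^sup>2"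
      using tail[of "e/2"] by auto
    have "norm (X m - Abs_ell2 x) \<le> e/2" if "m \<ge> N" for m
      using N that e by (intro norm_ell2_leI) (auto simp: entry_x)
    then have "\<forall>m\<ge>N. dist (X m) (Abs_ell2 x) < e" using e by (force simp: dist_norm)
    then show "\<exists>N. \<forall>m\<ge>N. dist (X m) (Abs_ell2 x) < e" by blast
  qed
  then show "convergent X" unfolding convergent_def by blast
qed

section \<open>The lattice equations\<close>

lift_definition delta_plus :: "ell2 \<Rightarrow> ell2" ("\<delta>\<^sup>+") is "\<lambda>q j. q (j + 1) - q j"
  by (intro square_summable_diff square_summable_shift)

lift_definition delta_minus :: "ell2 \<Rightarrow> ell2" ("\<delta>\<^sup>-") is "\<lambda>q j. - (q (j - 1) - q j)"
  using square_summable_shift[of _ "-1"] by (auto intro!: square_summable_minus square_summable_diff)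

text \<open>
  Entrywise application of a scalar function to a sequence.  The resulting sequence has to be
  square-summable again for this to be meaningful; \<open>entry_map_ell2\<close> below guarantees this
  for continuously differentiable functions vanishing at the origin.
\<close>

definition map_ell2 :: "(real \<Rightarrow> real) \<Rightarrow> ell2 \<Rightarrow> ell2" where
  "map_ell2 f x = Abs_ell2 (\<lambda>j. f (entry x j))"

lemma entry_map_ell2:
  assumes f: "\<And>x. (f has_real_derivative f' x) (at x)"
    and f': "continuous_on UNIV f'" and "f 0 = 0"
  shows "entry (map_ell2 f x) j = f (entry x j)"
proof -
  define M where "M = norm x"
  have "compact (f' ` {-M..M})"
    using f' by (intro compact_continuous_image) (auto intro: continuous_on_subset)
  then obtain L where L: "\<And>y. y \<in> {-M..M} \<Longrightarrow> \<bar>f' y\<bar> \<le> L"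
    by (metis bounded_iff compact_imp_bounded image_eqI real_norm_def)
  have bound: "\<bar>f y\<bar> \<le> L * \<bar>y\<bar>" if "y \<in> {-M..M}" for y
  proof -
    have "0 \<in> {-M..M}" using that by auto
    have "norm (f y - f 0) \<le> L * norm (y - 0)"
      using f L that \<open>0 \<in> {-M..M}\<close>
      by (intro field_differentiable_bound[of "{-M..M}" f f'])
        (auto intro: has_field_derivative_at_within)
    then show ?thesis using \<open>f 0 = 0\<close> by simp
  qed
  have "(f (entry x j))\<^sup>2 \<le> L\<^sup>2 * (entry x j)\<^sup>2" for j
    using bound[of "entry x j"] abs_entry_le_norm[of x j] power_mono[of "\<bar>f (entry x j)\<bar>" _ 2]
    by (force simp: M_def power_mult_distrib)
  moreover have "(\<lambda>j. L\<^sup>2 * (entry x j)\<^sup>2) summable_on UNIV"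
    using square_summable_entry[of x] unfolding square_summable_def
    by (intro summable_on_cmult_right)
  ultimately have "square_summable (\<lambda>j. f (entry x j))"
    unfolding square_summable_def by (auto intro: summable_on_comparison_test)
  then show ?thesis by (simp add: map_ell2_def Abs_ell2_inverse)
qed

definition smooth :: "(real \<Rightarrow> real) \<Rightarrow> bool" where
  "smooth f \<longleftrightarrow> (\<forall>n x. (deriv ^^ n) f field_differentiable at x)"

lemma entry_map_ell2_deriv:
  assumes "smooth V" "deriv V 0 = 0"
  shows "entry (map_ell2 (deriv V) x) j = deriv V (entry x j)"
proof (rule entry_map_ell2)
  have d: "(deriv ^^ n) V field_differentiable at y" for n y
    using assms(1) by (simp add: smooth_def)
  show "(deriv V has_real_derivative deriv (deriv V) y) (at y)" for y
    using d[of 1 y] by (simp add: field_differentiable_derivI)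
  have "(deriv ^^ 2) V field_differentiable at y" for y by (rule d)
  then show "continuous_on UNIV (deriv (deriv V))"
    by (intro continuous_at_imp_continuous_on ballI)
      (auto simp: numeral_2_eq_2 intro: field_differentiable_imp_continuous_at)
qed (rule assms(2))

text \<open>
  Time derivatives are derivatives with respect to the \<open>\<ell>\<^sup>2\<close>-norm, one-sided at the
  end points of the time interval \<open>J\<close>.
\<close>

definition solves_FPUT ::
    "(real \<Rightarrow> real) \<Rightarrow> real set \<Rightarrow> (real \<Rightarrow> ell2) \<Rightarrow> (real \<Rightarrow> ell2) \<Rightarrow> bool" where
  "solves_FPUT V J R P \<longleftrightarrow> (\<forall>t\<in>J.
     (R has_vector_derivative \<delta>\<^sup>+ (P t)) (at t within J) \<and>
     (P has_vector_derivative \<delta>\<^sup>- (map_ell2 (deriv V) (R t))) (at t within J))"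

definition solves_MiM ::
    "(real \<Rightarrow> real) \<Rightarrow> real \<Rightarrow> real \<Rightarrow> real set \<Rightarrow> (real \<Rightarrow> ell2) \<Rightarrow> (real \<Rightarrow> ell2) \<Rightarrow>
     (real \<Rightarrow> ell2) \<Rightarrow> (real \<Rightarrow> ell2) \<Rightarrow> bool" where
  "solves_MiM V \<kappa> \<mu> J R P r p \<longleftrightarrow> (\<forall>t\<in>J.
     (R has_vector_derivative \<delta>\<^sup>+ (P t)) (at t within J) \<and>
     (P has_vector_derivative \<delta>\<^sup>- (map_ell2 (deriv V) (R t)) + \<kappa> *\<^sub>R r t) (at t within J) \<and>
     (r has_vector_derivative p t - P t) (at t within J) \<and>
     (\<exists>p'. (p has_vector_derivative p') (at t within J) \<and> \<mu> *\<^sub>R p' = - \<kappa> *\<^sub>R r t))"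

definition mu_norm :: "real \<Rightarrow> real \<Rightarrow> real \<Rightarrow> ell2 \<times> ell2 \<times> ell2 \<times> ell2 \<Rightarrow> real" where
  "mu_norm k \<kappa> \<mu> = (\<lambda>(R, P, r, p).
     sqrt (k / 2 * (norm R)\<^sup>2 + 1 / 2 * (norm P)\<^sup>2 + \<kappa> / 2 * (norm r)\<^sup>2 + \<mu> / 2 * (norm p)\<^sup>2))"

end

theory Submission
  imports Defs
begin

text \<open>
  The quadruple $(\tilde R, \tilde P, 0, \tilde P)$ built from an FPUT solution satisfies the first
  three mass-in-mass equations exactly and the last one up to the residual
  $\mu\,\delta^-[V'(\tilde R)]$. Put $A = R - \tilde R$, $B = P - \tilde P$,
  $q = p - \tilde P$. In the time derivative of the error energy
  $E = \frac k2\|A\|^2 + \frac12\|B\|^2 + \frac\kappa2\|r\|^2 + \frac\mu2\|q\|^2$, which is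
  the square of the $\mu$-norm, the coupling terms with $\kappa$ cancel
  (\<open>error_energy_derivative\<close>). This cancellation removes the stiffness of the last equation: what
  is left is bounded by $a E + \mu b$ with $a$ and $b$ independent of $\mu$, where the residual
  is absorbed through $2\mu\|q\|\,\|V'(\tilde R)\| \le \mu\|q\|^2 + \mu\|V'(\tilde R)\|^2$
  (\<open>error_energy_growth\<close>). Gronwall's inequality turns $E(0) = O(\mu)$ into $E(t) = O(\mu)$.

  The constants involve a Lipschitz constant of $V'$, hence uniform bounds on $\tilde R$ and $R$.
  For $\tilde R$ they come from conservation of the FPUT energy
  $\frac12\|\tilde P\|^2 + \sum_j V(\tilde R_j)$: near the origin $V$ is comparable to a
  quadratic, so the energy of small data confines $\tilde R$ to a small ball for all times,
  with a radius independent of $T$ (\<open>FPUT_small\<close>). For $R$ they hold as long as $E \le k/2$,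
  because then $\|A\| \le 1$; for small $\mu$ the Gronwall bound stays strictly below this
  threshold, so that the threshold is never reached (\<open>Gronwall_barrier\<close>).
\<close>

section \<open>Difference operators on the sequence space\<close>

lemma norm_delta_plus_le: "norm (\<delta>\<^sup>+ q) \<le> 2 * norm q"
proof (rule norm_ell2_leI)
  fix F :: "int set" assume F: "finite F"
  have shift: "(\<Sum>j\<in>F. (entry q (j + 1))\<^sup>2) \<le> (norm q)\<^sup>2"
    using sum_entry_le_norm[of "(\<lambda>j. j + 1) ` F" q] F by (simp add: sum.reindex inj_on_def)
  have "(\<Sum>j\<in>F. (entry (\<delta>\<^sup>+ q) j)\<^sup>2) \<le> (\<Sum>j\<in>F. 2 * (entry q (j + 1))\<^sup>2 + 2 * (entry q j)\<^sup>2)"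
  proof (rule sum_mono)
    fix j
    have "(a - b)\<^sup>2 \<le> 2 * a\<^sup>2 + 2 * b\<^sup>2" for a b :: real
      using zero_le_power2[of "a + b"] by (simp add: power2_eq_square algebra_simps)
    then show "(entry (\<delta>\<^sup>+ q) j)\<^sup>2 \<le> 2 * (entry q (j + 1))\<^sup>2 + 2 * (entry q j)\<^sup>2"
      by (simp add: delta_plus.rep_eq)
  qed
  also have "\<dots> \<le> (2 * norm q)\<^sup>2"
    using shift sum_entry_le_norm[OF F, of q]
    by (simp add: sum.distrib sum_distrib_left[symmetric] power_mult_distrib)
  finally show "(\<Sum>j\<in>F. (entry (\<delta>\<^sup>+ q) j)\<^sup>2) \<le> (2 * norm q)\<^sup>2" .
qed simp

lemma summable_on_diff:
  fixes f g :: "'a \<Rightarrow> real"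
  assumes "f summable_on A" "g summable_on A"
  shows "(\<lambda>x. f x - g x) summable_on A"
  using summable_on_add[OF assms(1), of "\<lambda>x. - g x"] assms(2) by (simp add: summable_on_uminus)

lemma infsum_diff:
  fixes f g :: "'a \<Rightarrow> real"
  assumes "f summable_on A" "g summable_on A"
  shows "(\<Sum>\<^sub>\<infinity>x\<in>A. f x - g x) = infsum f A - infsum g A"
  using infsum_add[OF assms(1), of "\<lambda>x. - g x"] assms(2)
  by (simp add: summable_on_uminus infsum_uminus)

text \<open>Summation by parts; square-summability leaves no boundary terms.\<close>

lemma inner_delta_minus: "inner x (\<delta>\<^sup>- y) = - inner (\<delta>\<^sup>+ x) y"
proof -
  have sx: "square_summable (\<lambda>j. entry x (j + 1))" and sy: "square_summable (\<lambda>j. entry y (j - 1))"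
    using square_summable_shift[OF square_summable_entry, of x 1]
      square_summable_shift[OF square_summable_entry, of y "-1"] by simp_all
  note p = square_summable_prod[OF square_summable_entry square_summable_entry, of x y]
    square_summable_prod[OF square_summable_entry sy, of x]
    square_summable_prod[OF sx square_summable_entry, of y]
  have bij: "bij_betw (\<lambda>j. j + 1) UNIV (UNIV :: int set)"
    by (rule bij_betw_byWitness[where f' = "\<lambda>j. j - 1"]) auto
  have shift: "(\<Sum>\<^sub>\<infinity>j. entry x j * entry y (j - 1)) = (\<Sum>\<^sub>\<infinity>j. entry x (j + 1) * entry y j)"
    using infsum_reindex_bij_betw[OF bij, of "\<lambda>j. entry x j * entry y (j - 1)"] by simp
  have "inner x (\<delta>\<^sup>- y) = (\<Sum>\<^sub>\<infinity>j. entry x j * entry y j - entry x j * entry y (j - 1))"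
    by (simp add: inner_ell2.rep_eq delta_minus.rep_eq algebra_simps)
  also have "\<dots> = (\<Sum>\<^sub>\<infinity>j. entry x j * entry y j) - (\<Sum>\<^sub>\<infinity>j. entry x (j + 1) * entry y j)"
    using p by (simp add: infsum_diff shift)
  also have "\<dots> = - (\<Sum>\<^sub>\<infinity>j. entry x (j + 1) * entry y j - entry x j * entry y j)"
    using p by (simp add: infsum_diff)
  also have "\<dots> = - inner (\<delta>\<^sup>+ x) y"
    by (simp add: inner_ell2.rep_eq delta_plus.rep_eq algebra_simps)
  finally show ?thesis .
qed

lemma delta_plus_diff: "\<delta>\<^sup>+ (x - y) = \<delta>\<^sup>+ x - \<delta>\<^sup>+ y"
  by (rule ell2_eqI) (simp add: delta_plus.rep_eq)

lemma delta_minus_diff: "\<delta>\<^sup>- (x - y) = \<delta>\<^sup>- x - \<delta>\<^sup>- y"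
  by (rule ell2_eqI) (simp add: delta_minus.rep_eq)

section \<open>The potential acting entrywise on sequences\<close>

lemma smooth_DERIV:
  assumes "smooth V"
  shows "((deriv ^^ n) V has_real_derivative (deriv ^^ Suc n) V x) (at x)"
  using assms by (simp add: smooth_def field_differentiable_derivI)

lemma smooth_DERIV_2: "smooth V \<Longrightarrow> (deriv V has_real_derivative deriv (deriv V) x) (at x)"
  using smooth_DERIV[of V 1 x] by simp

lemma smooth_isCont_deriv2: "smooth V \<Longrightarrow> isCont (deriv (deriv V)) x"
  using DERIV_isCont[OF smooth_DERIV[of V 2 x]] by (simp add: numeral_2_eq_2)

lemma smooth_deriv2_bounded:
  assumes "smooth V"
  obtains L where "L \<ge> 0" "\<And>x. \<bar>x\<bar> \<le> N \<Longrightarrow> \<bar>deriv (deriv V) x\<bar> \<le> L"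
proof -
  have "compact (deriv (deriv V) ` {-N..N})"
    using smooth_isCont_deriv2[OF assms]
    by (intro compact_continuous_image continuous_at_imp_continuous_on) auto
  then obtain L where "\<forall>y\<in>deriv (deriv V) ` {-N..N}. norm y \<le> L"
    using bounded_iff compact_imp_bounded by blast
  then show thesis by (intro that[of "max L 0"]) (auto simp: abs_le_iff max.coboundedI1)
qed

lemma smooth_Taylor2:
  assumes "smooth V" "\<bar>x\<bar> \<le> N" "\<bar>y\<bar> \<le> N"
  obtains t where "\<bar>t\<bar> \<le> N"
    "V y = V x + deriv V x * (y - x) + deriv (deriv V) t / 2 * (y - x)\<^sup>2"
proof (cases "y = x")
  case True
  then show ?thesis using that[of x] assms by simp
next
  case False
  have "\<exists>t. (if y < x then y < t \<and> t < x else x < t \<and> t < y) \<and>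
     V y = (\<Sum>m<2. (deriv ^^ m) V x / fact m * (y - x) ^ m) + (deriv ^^ 2) V t / fact 2 * (y - x) ^ 2"
    using smooth_DERIV[OF assms(1)] assms(2,3) False
    by (intro Taylor[of 2 "\<lambda>m. (deriv ^^ m) V" V "-N" N]) auto
  then obtain t where "if y < x then y < t \<and> t < x else x < t \<and> t < y"
    "V y = (\<Sum>m<2. (deriv ^^ m) V x / fact m * (y - x) ^ m) + (deriv ^^ 2) V t / fact 2 * (y - x) ^ 2"
    by blast
  then show ?thesis using assms(2,3)
    by (intro that[of t]) (auto simp: numeral_2_eq_2 split: if_splits)
qed

lemma smooth_deriv_Lipschitz:
  assumes "smooth V" "\<And>x. \<bar>x\<bar> \<le> N \<Longrightarrow> \<bar>deriv (deriv V) x\<bar> \<le> L" "\<bar>x\<bar> \<le> N" "\<bar>y\<bar> \<le> N"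
  shows "\<bar>deriv V y - deriv V x\<bar> \<le> L * \<bar>y - x\<bar>"
proof -
  have "norm (deriv V y - deriv V x) \<le> L * norm (y - x)"
    by (rule field_differentiable_bound[of "{-N..N}" "deriv V" "deriv (deriv V)"])
      (use assms smooth_DERIV_2[OF assms(1)] in \<open>auto intro: has_field_derivative_at_within\<close>)
  then show ?thesis by simp
qed

text \<open>Entries are bounded by the norm, so the scalar Lipschitz constant of $V'$ on $[-N, N]$ serves
  for the whole ball of radius $N$ in $\ell^2$.\<close>

lemma norm_map_deriv_diff_le:
  assumes V: "smooth V" "deriv V 0 = 0"
    and L: "L \<ge> 0" "\<And>x. \<bar>x\<bar> \<le> N \<Longrightarrow> \<bar>deriv (deriv V) x\<bar> \<le> L"
    and "norm x \<le> N" "norm y \<le> N"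
  shows "norm (map_ell2 (deriv V) x - map_ell2 (deriv V) y) \<le> L * norm (x - y)"
proof (rule norm_ell2_leI)
  fix F :: "int set" assume F: "finite F"
  have "(\<Sum>j\<in>F. (entry (map_ell2 (deriv V) x - map_ell2 (deriv V) y) j)\<^sup>2)
      \<le> (\<Sum>j\<in>F. L\<^sup>2 * (entry (x - y) j)\<^sup>2)"
  proof (rule sum_mono)
    fix j
    have "\<bar>deriv V (entry x j) - deriv V (entry y j)\<bar> \<le> L * \<bar>entry x j - entry y j\<bar>"
      using abs_entry_le_norm[of x j] abs_entry_le_norm[of y j] assms
      by (intro smooth_deriv_Lipschitz[of V N]) auto
    from power_mono[OF this, of 2]
    show "(entry (map_ell2 (deriv V) x - map_ell2 (deriv V) y) j)\<^sup>2 \<le> L\<^sup>2 * (entry (x - y) j)\<^sup>2"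
      by (simp add: entry_map_ell2_deriv[OF V] power_mult_distrib)
  qed
  also have "\<dots> \<le> (L * norm (x - y))\<^sup>2"
    unfolding sum_distrib_left[symmetric] power_mult_distrib
    by (intro mult_left_mono sum_entry_le_norm F) auto
  finally show "(\<Sum>j\<in>F. (entry (map_ell2 (deriv V) x - map_ell2 (deriv V) y) j)\<^sup>2)
      \<le> (L * norm (x - y))\<^sup>2" .
qed (use L in simp)

lemma map_deriv_0:
  assumes "smooth V" "deriv V 0 = 0"
  shows "map_ell2 (deriv V) 0 = 0"
  by (rule ell2_eqI) (simp add: entry_map_ell2_deriv assms)

definition potential_energy :: "(real \<Rightarrow> real) \<Rightarrow> ell2 \<Rightarrow> real" where
  "potential_energy V x = (\<Sum>\<^sub>\<infinity>j. V (entry x j))"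

lemma entry_square_summable: "(\<lambda>j. (entry x j)\<^sup>2) summable_on UNIV"
  using square_summable_entry[of x] by (simp add: square_summable_def)

text \<open>$V$ vanishes to second order at the origin, so its values along a square-summable sequence are
  dominated by the squares of the entries.\<close>

lemma potential_summable:
  assumes V: "smooth V" "V 0 = 0" "deriv V 0 = 0"
  shows "(\<lambda>j. V (entry x j)) summable_on UNIV"
proof -
  obtain L where L: "L \<ge> 0" "\<And>y. \<bar>y\<bar> \<le> norm x \<Longrightarrow> \<bar>deriv (deriv V) y\<bar> \<le> L"
    using smooth_deriv2_bounded[OF V(1), of "norm x"] by blast
  have "(\<lambda>j. L * (entry x j)\<^sup>2) summable_on UNIV"
    by (intro summable_on_cmult_right entry_square_summable)
  moreover have "norm (V (entry x j)) \<le> L * (entry x j)\<^sup>2" for j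
  proof -
    obtain t where t: "\<bar>t\<bar> \<le> norm x" "V (entry x j) = deriv (deriv V) t / 2 * (entry x j)\<^sup>2"
      using smooth_Taylor2[OF V(1), of 0 "norm x" "entry x j"] abs_entry_le_norm[of x j] V by auto
    have "\<bar>deriv (deriv V) t / 2\<bar> \<le> L" using L(2)[OF t(1)] L(1) by simp
    then show ?thesis unfolding t(2) real_norm_def abs_mult[of "deriv (deriv V) t / 2"]
      by (simp add: mult_right_mono del: abs_divide)
  qed
  ultimately have "(\<lambda>j. norm (V (entry x j))) summable_on UNIV"
    by (intro summable_on_comparison_test[where g = "\<lambda>j. norm (V (entry x j))"]) auto
  then show ?thesis by (rule abs_summable_summable)
qed

text \<open>The second-order Taylor remainders of the entries sum to $O(\|y-x\|^2)$, with one constant for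
  all entries since these all lie in one compact interval.\<close>

lemma potential_energy_has_derivative:
  assumes V: "smooth V" "V 0 = 0" "deriv V 0 = 0"
  shows "(potential_energy V has_derivative (\<lambda>h. inner (map_ell2 (deriv V) x) h)) (at x)"
proof -
  define N where "N = norm x + 1"
  obtain L where L: "L \<ge> 0" "\<And>y. \<bar>y\<bar> \<le> N \<Longrightarrow> \<bar>deriv (deriv V) y\<bar> \<le> L"
    using smooth_deriv2_bounded[OF V(1), of N] by blast
  have rem: "\<bar>potential_energy V y - potential_energy V x - inner (map_ell2 (deriv V) x) (y - x)\<bar>
      \<le> L * (norm (y - x))\<^sup>2" if y: "norm y \<le> N" for y
  proof -
    define g where "g j = V (entry y j) - V (entry x j)
        - entry (map_ell2 (deriv V) x) j * entry (y - x) j" for j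
    have s: "(\<lambda>j. V (entry y j) - V (entry x j)) summable_on UNIV"
      by (intro summable_on_diff potential_summable V)
    note s' = square_summable_prod[OF square_summable_entry square_summable_entry,
        of "map_ell2 (deriv V) x" "y - x"]
    have gs: "g summable_on UNIV" unfolding g_def by (intro summable_on_diff s s')
    have eq: "potential_energy V y - potential_energy V x - inner (map_ell2 (deriv V) x) (y - x)
        = (\<Sum>\<^sub>\<infinity>j. g j)"
      unfolding g_def infsum_diff[OF s s']
        infsum_diff[OF potential_summable[OF V] potential_summable[OF V]]
      by (simp add: potential_energy_def inner_ell2.rep_eq)
    have g: "\<bar>g j\<bar> \<le> L * (entry (y - x) j)\<^sup>2" for j
    proof -
      obtain t where t: "\<bar>t\<bar> \<le> N" "V (entry y j) = V (entry x j)
          + deriv V (entry x j) * (entry y j - entry x j)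
          + deriv (deriv V) t / 2 * (entry y j - entry x j)\<^sup>2"
        using smooth_Taylor2[OF V(1), of "entry x j" N "entry y j"]
          abs_entry_le_norm[of x j] abs_entry_le_norm[of y j] y by (auto simp: N_def)
      have bound: "\<bar>deriv (deriv V) t / 2\<bar> \<le> L" using L(2)[OF t(1)] L(1) by simp
      moreover have "g j = deriv (deriv V) t / 2 * (entry (y - x) j)\<^sup>2"
        unfolding g_def t(2) by (simp add: entry_map_ell2_deriv[OF V(1,3)])
      ultimately have "\<bar>g j\<bar> = \<bar>deriv (deriv V) t / 2\<bar> * (entry (y - x) j)\<^sup>2"
        by (simp only: abs_mult abs_power2)
      with bound show ?thesis by (simp only: mult_right_mono zero_le_power2)
    qed
    have bs: "(\<lambda>j. L * (entry (y - x) j)\<^sup>2) summable_on UNIV"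
      by (intro summable_on_cmult_right entry_square_summable)
    have total: "(\<Sum>\<^sub>\<infinity>j. L * (entry (y - x) j)\<^sup>2) = L * (norm (y - x))\<^sup>2"
      unfolding norm_ell2_power2 by (rule infsum_cmult_right')
    have "(\<Sum>\<^sub>\<infinity>j. g j) \<le> (\<Sum>\<^sub>\<infinity>j. L * (entry (y - x) j)\<^sup>2)"
      using g by (intro infsum_mono gs bs) (simp add: abs_le_iff)
    moreover have "(\<Sum>\<^sub>\<infinity>j. - g j) \<le> (\<Sum>\<^sub>\<infinity>j. L * (entry (y - x) j)\<^sup>2)"
      using g gs by (intro infsum_mono bs) (simp_all add: abs_le_iff summable_on_uminus)
    ultimately show ?thesis unfolding eq total by (simp add: infsum_uminus abs_le_iff)
  qed
  show ?thesis unfolding has_derivative_within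
  proof (intro conjI)
    show "bounded_linear (inner (map_ell2 (deriv V) x))" by (rule bounded_linear_inner_right)
    show "((\<lambda>y. (1 / norm (y - x)) *\<^sub>R (potential_energy V y -
        (potential_energy V x + inner (map_ell2 (deriv V) x) (y - x)))) \<longlongrightarrow> 0) (at x)"
    proof (rule Lim_null_comparison)
      have "\<forall>\<^sub>F y in at x. dist y x < 1" by (auto simp: eventually_at intro: exI[of _ 1])
      then show "\<forall>\<^sub>F y in at x. norm ((1 / norm (y - x)) *\<^sub>R (potential_energy V y -
          (potential_energy V x + inner (map_ell2 (deriv V) x) (y - x)))) \<le> L * norm (y - x)"
      proof eventually_elim
        case (elim y)
        then have "norm y \<le> N"
          using norm_triangle_ineq[of x "y - x"] by (simp add: N_def dist_norm)
        from rem[OF this] show ?case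
          by (cases "y = x") (simp_all add: diff_diff_eq pos_divide_le_eq power2_eq_square mult.assoc)
      qed
      show "((\<lambda>y. L * norm (y - x)) \<longlongrightarrow> 0) (at x)"
        by (auto intro!: tendsto_eq_intros)
    qed
  qed
qed

lemma potential_energy_bounds:
  assumes V: "smooth V" "V 0 = 0" "deriv V 0 = 0"
    and d: "\<And>x. \<bar>x\<bar> \<le> d \<Longrightarrow> a \<le> deriv (deriv V) x \<and> deriv (deriv V) x \<le> b"
    and x: "norm x \<le> d"
  shows "a / 2 * (norm x)\<^sup>2 \<le> potential_energy V x" "potential_energy V x \<le> b / 2 * (norm x)\<^sup>2"
proof -
  have V': "a / 2 * (entry x j)\<^sup>2 \<le> V (entry x j) \<and> V (entry x j) \<le> b / 2 * (entry x j)\<^sup>2" for j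
  proof -
    obtain t where t: "\<bar>t\<bar> \<le> d" "V (entry x j) = deriv (deriv V) t / 2 * (entry x j)\<^sup>2"
      using smooth_Taylor2[OF V(1), of 0 d "entry x j"] abs_entry_le_norm[of x j] V x
      by (auto simp: order_trans[OF norm_ge_zero x])
    show ?thesis unfolding t(2) using d[OF t(1)] by (auto intro!: mult_right_mono)
  qed
  have s: "(\<lambda>j. c * (entry x j)\<^sup>2) summable_on UNIV" for c
    by (intro summable_on_cmult_right entry_square_summable)
  have e: "(\<Sum>\<^sub>\<infinity>j. c * (entry x j)\<^sup>2) = c * (norm x)\<^sup>2" for c
    unfolding norm_ell2_power2 by (rule infsum_cmult_right')
  show "a / 2 * (norm x)\<^sup>2 \<le> potential_energy V x"
    unfolding potential_energy_def e[symmetric]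
    using V' by (intro infsum_mono s potential_summable V) auto
  show "potential_energy V x \<le> b / 2 * (norm x)\<^sup>2"
    unfolding potential_energy_def e[symmetric]
    using V' by (intro infsum_mono s potential_summable V) auto
qed

section \<open>Differential inequalities\<close>

lemma has_real_derivative_norm_power2:
  fixes f :: "real \<Rightarrow> 'a::real_inner"
  assumes "(f has_vector_derivative f') (at t within S)"
  shows "((\<lambda>t. (norm (f t))\<^sup>2) has_real_derivative 2 * inner (f t) f') (at t within S)"
proof -
  have "((\<lambda>t. inner (f t) (f t)) has_derivative (\<lambda>h. inner (f t) (h *\<^sub>R f') + inner (h *\<^sub>R f') (f t)))
      (at t within S)"
    using assms unfolding has_vector_derivative_def by (intro has_derivative_inner)
  moreover have "(\<lambda>h. inner (f t) (h *\<^sub>R f') + inner (h *\<^sub>R f') (f t)) = (*) (2 * inner (f t) f')"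
    by (simp add: fun_eq_iff inner_commute)
  ultimately show ?thesis by (simp add: has_field_derivative_def power2_norm_eq_inner)
qed

text \<open>The differential inequality is available only below the level $M$. At the first time at which
  $E$ reaches $M$, the inequality would have been valid throughout the past; Gronwall's bound at
  that time would then give a value smaller than $M$. So there is no such time.\<close>

lemma Gronwall_barrier_forward:
  fixes E :: "real \<Rightarrow> real"
  assumes deriv: "\<And>s. s \<in> {0<..<T} \<Longrightarrow> (E has_real_derivative E' s) (at s)"
    and cont: "continuous_on {0..T} E"
    and ineq: "\<And>s. s \<in> {0<..<T} \<Longrightarrow> E s \<le> M \<Longrightarrow> E' s \<le> a * E s + b"
    and ab: "a > 0" "b \<ge> 0"
    and E0: "0 \<le> E 0" "(E 0 + b / a) * exp (a * T) < M"
    and t: "t \<in> {0..T}"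
  shows "E t \<le> (E 0 + b / a) * exp (a * T)"
proof -
  have below: "E u \<le> (E 0 + b / a) * exp (a * T)"
    if u: "u \<in> {0..T}" and le: "\<And>s. s \<in> {0<..<u} \<Longrightarrow> E s \<le> M" for u
  proof -
    \<comment> \<open>The shift by \<open>b / a\<close> absorbs the inhomogeneous term, and the integrating factor leaves a
      nonincreasing function.\<close>
    define F where "F s = (E s + b / a) * exp (- a * s)" for s
    have "F u \<le> F 0"
    proof (rule DERIV_nonpos_imp_decreasing_open[of 0 u F])
      fix s assume s: "0 < s" "s < u"
      then have sT: "s \<in> {0<..<T}" using u by auto
      have "(F has_real_derivative (E' s - a * (E s + b / a)) * exp (- a * s)) (at s)"
        unfolding F_def by (auto intro!: derivative_eq_intros deriv sT simp: algebra_simps)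
      moreover have "E' s - a * (E s + b / a) \<le> 0"
        using ineq[OF sT] le[of s] s ab by (simp add: algebra_simps)
      ultimately show "\<exists>y. (F has_real_derivative y) (at s) \<and> y \<le> 0"
        by (meson exp_ge_zero mult_nonpos_nonneg)
    next
      show "continuous_on {0..u} F" unfolding F_def
        using u by (intro continuous_intros continuous_on_subset[OF cont]) auto
    qed (use u in auto)
    then have "E u + b / a \<le> (E 0 + b / a) * exp (a * u)"
      by (simp add: F_def exp_minus field_simps)
    also have "\<dots> \<le> (E 0 + b / a) * exp (a * T)"
      using u ab E0 by (intro mult_left_mono) auto
    finally show ?thesis using ab by (smt (verit) divide_nonneg_pos)
  qed
  define S where "S = {s \<in> {0..T}. M \<le> E s}"
  have "S = {}"
  proof (rule ccontr)
    assume "S \<noteq> {}"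
    have "closed S" unfolding S_def
      by (intro continuous_on_closed_Collect_le cont) auto
    moreover have "bounded S" unfolding S_def by (rule bounded_subset[of "{0..T}"]) auto
    ultimately have "compact S" by (simp add: compact_eq_bounded_closed)
    then obtain s where s: "s \<in> S" "\<And>u. u \<in> S \<Longrightarrow> s \<le> u"
      using compact_attains_inf[OF _ \<open>S \<noteq> {}\<close>] by blast
    have "\<not> M \<le> E u" if "u \<in> {0<..<s}" for u
      using s(1) s(2)[of u] that by (auto simp: S_def)
    then have "E s \<le> (E 0 + b / a) * exp (a * T)" using s(1)
      by (intro below) (auto simp: S_def intro: less_imp_le simp: not_le)
    then show False using s(1) E0(2) by (simp add: S_def)
  qed
  then have "E s \<le> M" if "s \<in> {0..T}" for s using that by (force simp: S_def)
  then show ?thesis using below[OF t] t by auto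
qed

text \<open>With the derivative bounded in absolute value, reflecting time yields the estimate for negative
  times.\<close>

lemma Gronwall_barrier:
  fixes E :: "real \<Rightarrow> real"
  assumes deriv: "\<And>s. s \<in> {-T..T} \<Longrightarrow> (E has_real_derivative E' s) (at s within {-T..T})"
    and ineq: "\<And>s. s \<in> {-T..T} \<Longrightarrow> E s \<le> M \<Longrightarrow> \<bar>E' s\<bar> \<le> a * E s + b"
    and ab: "a > 0" "b \<ge> 0"
    and E0: "0 \<le> E 0" "(E 0 + b / a) * exp (a * T) < M"
    and t: "t \<in> {-T..T}"
  shows "E t \<le> (E 0 + b / a) * exp (a * T)"
proof -
  have cont: "continuous_on {-T..T} E"
    using deriv by (meson DERIV_continuous continuous_on_eq_continuous_within)
  have inner: "(E has_real_derivative E' s) (at s)" if "s \<in> {-T<..<T}" for s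
    using deriv[of s] that at_within_interior[of s "{-T..T}"] by (auto simp: interior_atLeastAtMost_real)
  show ?thesis
  proof (cases "t \<ge> 0")
    case True
    show ?thesis
    proof (rule Gronwall_barrier_forward[where E' = E' and M = M])
      show "continuous_on {0..T} E" by (rule continuous_on_subset[OF cont]) (use t True in auto)
      show "(E has_real_derivative E' s) (at s)" if "s \<in> {0<..<T}" for s
        using inner[of s] that by auto
      show "E' s \<le> a * E s + b" if "s \<in> {0<..<T}" "E s \<le> M" for s
        using ineq[of s] that by auto
    qed (use ab E0 t True in auto)
  next
    case False
    have "E (- (- t)) \<le> (E (- 0) + b / a) * exp (a * T)"
    proof (rule Gronwall_barrier_forward[where E = "\<lambda>s. E (- s)" and E' = "\<lambda>s. - E' (- s)" and M = M])
      show "continuous_on {0..T} (\<lambda>s. E (- s))"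
        by (rule continuous_on_compose2[OF cont]) (auto intro!: continuous_intros)
      show "((\<lambda>s. E (- s)) has_real_derivative - E' (- s)) (at s)" if "s \<in> {0<..<T}" for s
        using inner[of "- s"] that by (auto simp: DERIV_mirror)
      show "- E' (- s) \<le> a * E (- s) + b" if "s \<in> {0<..<T}" "E (- s) \<le> M" for s
        using ineq[of "- s"] that by auto
    qed (use ab E0 t False in auto)
    then show ?thesis by simp
  qed
qed

section \<open>Small FPUT solutions stay small\<close>

text \<open>Along a solution the rates of change of the kinetic and of the potential energy are $\langle P, \delta^-[V'(R)]\rangle$ and
  $\langle V'(R), \delta^+P\rangle$, which are opposite by summation by parts.\<close>

lemma FPUT_energy_conserved:
  assumes V: "smooth V" "V 0 = 0" "deriv V 0 = 0"
    and sol: "solves_FPUT V {-T..T} R P" and t: "t \<in> {-T..T}"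
  shows "1 / 2 * (norm (P t))\<^sup>2 + potential_energy V (R t)
    = 1 / 2 * (norm (P 0))\<^sup>2 + potential_energy V (R 0)"
proof -
  define H where "H s = 1 / 2 * (norm (P s))\<^sup>2 + potential_energy V (R s)" for s
  have "(H has_derivative (\<lambda>h. 0)) (at s within {-T..T})" if s: "s \<in> {-T..T}" for s
  proof -
    have R: "(R has_vector_derivative \<delta>\<^sup>+ (P s)) (at s within {-T..T})"
      and P: "(P has_vector_derivative \<delta>\<^sup>- (map_ell2 (deriv V) (R s))) (at s within {-T..T})"
      using sol s by (auto simp: solves_FPUT_def)
    have "((\<lambda>s. potential_energy V (R s)) has_derivative
        (\<lambda>h. inner (map_ell2 (deriv V) (R s)) (h *\<^sub>R \<delta>\<^sup>+ (P s)))) (at s within {-T..T})"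
      using R potential_energy_has_derivative[OF V]
      unfolding has_vector_derivative_def by (rule has_derivative_compose)
    then have W: "((\<lambda>s. potential_energy V (R s)) has_real_derivative
        inner (map_ell2 (deriv V) (R s)) (\<delta>\<^sup>+ (P s))) (at s within {-T..T})"
      by (simp add: has_field_derivative_def mult_commute_abs)
    have "(H has_real_derivative 1 / 2 * (2 * inner (P s) (\<delta>\<^sup>- (map_ell2 (deriv V) (R s))))
        + inner (map_ell2 (deriv V) (R s)) (\<delta>\<^sup>+ (P s))) (at s within {-T..T})"
      unfolding H_def by (intro DERIV_add DERIV_cmult has_real_derivative_norm_power2 P W)
    then show ?thesis
      by (simp add: inner_delta_minus inner_commute has_field_derivative_def lambda_zero)
  qed
  then obtain c where "\<And>s. s \<in> {-T..T} \<Longrightarrow> H s = c"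
    using has_derivative_zero_constant[of "{-T..T}" H] by auto
  then show ?thesis using t unfolding H_def[symmetric] by auto
qed

text \<open>Energy conservation controls $\|R\|$ only where $V$ is known to be convex, that is, while
  $\|R\| \le d$. There it gives the better bound $\|R\| \le d/2$. The continuous function $\|R\|$
  hence takes no value in $(d/2, d]$ and, starting below this gap, cannot cross it.
  The size of the initial data is chosen to make the energy at most $\frac k4 (d/2)^2$.\<close>

lemma FPUT_small:
  fixes d k T :: real and R P :: "real \<Rightarrow> ell2"
  assumes V: "smooth V" "V 0 = 0" "deriv V 0 = 0" and k: "k > 0"
    and d: "d > 0" "\<And>x. \<bar>x\<bar> \<le> d \<Longrightarrow> k / 2 \<le> deriv (deriv V) x \<and> deriv (deriv V) x \<le> 2 * k"
    and sol: "solves_FPUT V {-T..T} R P" and t: "t \<in> {-T..T}"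
    and init: "norm (R 0) + norm (P 0) \<le> d / 2 * sqrt (k / (2 + 4 * k))"
  shows "norm (R t) \<le> d"
proof (rule ccontr)
  define \<rho> where "\<rho> = d / 2 * sqrt (k / (2 + 4 * k))"
  have \<rho>2: "(1 / 2 + k) * \<rho>\<^sup>2 = k / 4 * (d / 2)\<^sup>2"
    using k by (simp add: \<rho>_def power_mult_distrib field_simps power2_eq_square)
  have "k / (2 + 4 * k) \<le> 1" using k by simp
  then have \<rho>d: "\<rho> \<le> d / 2" using d(1) by (simp add: \<rho>_def mult_left_le)
  have small: "norm (R 0) \<le> \<rho>" "norm (P 0) \<le> \<rho>"
    using init norm_ge_zero[of "R 0"] norm_ge_zero[of "P 0"] unfolding \<rho>_def by linarith+
  have half: "norm (R s) \<le> d / 2" if s: "s \<in> {-T..T}" "norm (R s) \<le> d" for s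
  proof -
    have "k / 4 * (norm (R s))\<^sup>2 \<le> potential_energy V (R s)"
      using potential_energy_bounds(1)[OF V d(2) s(2)] by simp
    also have "\<dots> \<le> 1 / 2 * (norm (P s))\<^sup>2 + potential_energy V (R s)" by simp
    also have "\<dots> = 1 / 2 * (norm (P 0))\<^sup>2 + potential_energy V (R 0)"
      by (rule FPUT_energy_conserved[OF V sol s(1)])
    also have "\<dots> \<le> 1 / 2 * \<rho>\<^sup>2 + k * \<rho>\<^sup>2"
    proof (intro add_mono mult_left_mono power_mono small)
      have "potential_energy V (R 0) \<le> k * (norm (R 0))\<^sup>2"
        using potential_energy_bounds(2)[OF V d(2), where x = "R 0"] small(1) \<rho>d d(1) by simp
      also have "\<dots> \<le> k * \<rho>\<^sup>2" using k by (intro mult_left_mono power_mono small) auto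
      finally show "potential_energy V (R 0) \<le> k * \<rho>\<^sup>2" .
    qed auto
    also have "\<dots> = k / 4 * (d / 2)\<^sup>2" using \<rho>2 by (simp add: distrib_right)
    finally have "(norm (R s))\<^sup>2 \<le> (d / 2)\<^sup>2" using k by simp
    then show ?thesis using d(1) by (simp add: abs_le_square_iff[symmetric])
  qed
  assume "\<not> norm (R t) \<le> d"
  then have "d \<in> {norm (R 0)..norm (R t)}" using small(1) \<rho>d d(1) by auto
  have "continuous_on {-T..T} (\<lambda>s. norm (R s))"
    using sol unfolding solves_FPUT_def
    by (intro continuous_on_norm) (meson continuous_on_eq_continuous_within has_vector_derivative_continuous)
  then have "connected ((\<lambda>s. norm (R s)) ` {-T..T})"
    by (rule connected_continuous_image) auto
  then have "d \<in> (\<lambda>s. norm (R s)) ` {-T..T}"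
    by (rule connectedD_interval[of _ "norm (R 0)" "norm (R t)"])
      (use t \<open>d \<in> _\<close> in auto)
  then obtain s where "s \<in> {-T..T}" "d = norm (R s)" by blast
  then show False using half[of s] d(1) by simp
qed

section \<open>The energy of the approximation error\<close>

text \<open>Since $\mu\dot p = -\kappa r$, the terms $\kappa\langle B, r\rangle$,
  $\kappa\langle r, q - B\rangle$ and $-\kappa\langle q, r\rangle$ add up to zero. The remaining
  differences are moved onto the momenta by summation by parts, so that only $\delta^+$ has to be
  bounded.\<close>

lemma error_energy_derivative:
  assumes F: "solves_FPUT V J R' P'" and M: "solves_MiM V \<kappa> \<mu> J R P r p" and t: "t \<in> J"
  shows "((\<lambda>s. k / 2 * (norm (R s - R' s))\<^sup>2 + 1 / 2 * (norm (P s - P' s))\<^sup>2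
        + \<kappa> / 2 * (norm (r s))\<^sup>2 + \<mu> / 2 * (norm (p s - P' s))\<^sup>2) has_real_derivative
      (k * inner (R t - R' t) (\<delta>\<^sup>+ (P t - P' t))
        - inner (map_ell2 (deriv V) (R t) - map_ell2 (deriv V) (R' t)) (\<delta>\<^sup>+ (P t - P' t))
        + \<mu> * inner (map_ell2 (deriv V) (R' t)) (\<delta>\<^sup>+ (p t - P' t)))) (at t within J)"
proof -
  note F' = F[unfolded solves_FPUT_def, rule_format, OF t]
  note M' = M[unfolded solves_MiM_def, rule_format, OF t]
  obtain p' where p': "(p has_vector_derivative p') (at t within J)" "\<mu> *\<^sub>R p' = - \<kappa> *\<^sub>R r t"
    using M' by blast
  let ?f = "map_ell2 (deriv V) (R t)" and ?g = "map_ell2 (deriv V) (R' t)"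
  have \<mu>p': "\<mu> * inner x p' = - \<kappa> * inner x (r t)" for x
    using arg_cong[OF p'(2), of "inner x"] by simp
  have D: "((\<lambda>s. k / 2 * (norm (R s - R' s))\<^sup>2 + 1 / 2 * (norm (P s - P' s))\<^sup>2
        + \<kappa> / 2 * (norm (r s))\<^sup>2 + \<mu> / 2 * (norm (p s - P' s))\<^sup>2) has_real_derivative
      (k / 2 * (2 * inner (R t - R' t) (\<delta>\<^sup>+ (P t) - \<delta>\<^sup>+ (P' t)))
       + 1 / 2 * (2 * inner (P t - P' t) (\<delta>\<^sup>- ?f + \<kappa> *\<^sub>R r t - \<delta>\<^sup>- ?g))
       + \<kappa> / 2 * (2 * inner (r t) (p t - P t))
       + \<mu> / 2 * (2 * inner (p t - P' t) (p' - \<delta>\<^sup>- ?g)))) (at t within J)"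
    using F' M' p'(1)
    by (intro DERIV_add DERIV_cmult has_real_derivative_norm_power2 has_vector_derivative_diff) auto
  have i1: "inner (P t - P' t) (\<delta>\<^sup>- ?f + \<kappa> *\<^sub>R r t - \<delta>\<^sup>- ?g)
      = - inner (?f - ?g) (\<delta>\<^sup>+ (P t - P' t)) + \<kappa> * inner (P t - P' t) (r t)"
    using inner_delta_minus[of "P t - P' t" "?f - ?g"]
    by (simp add: delta_minus_diff inner_commute inner_diff_right inner_add_right
        inner_diff_left right_diff_distrib)
  have i2: "\<mu> * inner (p t - P' t) (p' - \<delta>\<^sup>- ?g)
      = - \<kappa> * inner (p t - P' t) (r t) + \<mu> * inner ?g (\<delta>\<^sup>+ (p t - P' t))"
    unfolding inner_diff_right[of _ p'] right_diff_distrib \<mu>p'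
    by (simp add: inner_delta_minus inner_commute)
  have i3: "inner (r t) (p t - P t) = inner (p t - P' t) (r t) - inner (P t - P' t) (r t)"
    by (simp add: inner_diff_left inner_diff_right inner_commute)
  show ?thesis
    by (rule DERIV_cong[OF D])
      (simp add: i1 i2 i3 delta_plus_diff[symmetric] right_diff_distrib distrib_left)
qed

text \<open>The level $k/2$ is the one that forces $\|R - \tilde R\| \le 1$, and thereby keeps both
  $R$ and $\tilde R$ in the ball of radius $d + 1$, on which $L$ is a Lipschitz constant.
  Products of norms are split by Young's inequality; the summand $2$ in the growth rate pays for
  $\mu\|q\|^2 \le 2E$.\<close>

lemma error_energy_growth:
  assumes V: "smooth V" "deriv V 0 = 0" and k: "k > 0" and "\<kappa> > 0" "\<mu> > 0"
    and L: "L \<ge> 0" "\<And>x. \<bar>x\<bar> \<le> d + 1 \<Longrightarrow> \<bar>deriv (deriv V) x\<bar> \<le> L"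
    and R': "norm R' \<le> d"
    and E: "E = k / 2 * (norm (R - R'))\<^sup>2 + 1 / 2 * (norm B)\<^sup>2 + \<kappa> / 2 * (norm r)\<^sup>2 + \<mu> / 2 * (norm q)\<^sup>2"
    and small: "E \<le> k / 2"
  shows "\<bar>k * inner (R - R') (\<delta>\<^sup>+ B)
      - inner (map_ell2 (deriv V) R - map_ell2 (deriv V) R') (\<delta>\<^sup>+ B)
      + \<mu> * inner (map_ell2 (deriv V) R') (\<delta>\<^sup>+ q)\<bar>
    \<le> (2 * (k + L) * (1 / k + 1) + 2) * E + \<mu> * (L * d)\<^sup>2"
proof -
  let ?A = "norm (R - R')" and ?f = "map_ell2 (deriv V) R" and ?g = "map_ell2 (deriv V) R'"
  have nonneg: "0 \<le> k / 2 * ?A\<^sup>2" "0 \<le> 1 / 2 * (norm B)\<^sup>2" "0 \<le> \<kappa> / 2 * (norm r)\<^sup>2"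
    "0 \<le> \<mu> / 2 * (norm q)\<^sup>2" using assms by auto
  have A2: "?A\<^sup>2 \<le> 2 * E / k" using nonneg E k by (simp add: field_simps)
  have B2: "(norm B)\<^sup>2 \<le> 2 * E" and q2: "\<mu> * (norm q)\<^sup>2 \<le> 2 * E" using nonneg E by linarith+
  have "k / 2 * ?A\<^sup>2 \<le> k / 2 * 1\<^sup>2" unfolding power_one mult_1_right using nonneg E small by linarith
  then have "?A \<le> 1" using k by (simp add: abs_square_le_1)
  then have "norm R \<le> d + 1" using norm_triangle_ineq[of R' "R - R'"] R' by simp
  then have fg: "norm (?f - ?g) \<le> L * ?A"
    using R' by (intro norm_map_deriv_diff_le[where N = "d + 1", OF V L]) auto
  have "norm (?g - map_ell2 (deriv V) 0) \<le> L * norm (R' - 0)"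
    using R' order_trans[OF norm_ge_zero R'] by (intro norm_map_deriv_diff_le[where N = "d + 1", OF V L]) auto
  also have "\<dots> \<le> L * d" using R' L(1) by (simp add: mult_left_mono)
  finally have g: "norm ?g \<le> L * d" by (simp add: map_deriv_0[OF V])
  have CS: "\<bar>inner x (\<delta>\<^sup>+ y)\<bar> \<le> c * (2 * norm y)" if "norm x \<le> c" for x y c
    using order_trans[OF Cauchy_Schwarz_ineq2[of x "\<delta>\<^sup>+ y"]
      mult_mono[OF that norm_delta_plus_le[of y]]] order_trans[OF norm_ge_zero that] by simp
  have AB: "2 * (?A * norm B) \<le> 2 * (1 / k + 1) * E"
    using sum_squares_bound[of ?A "norm B"] A2 B2 by (simp add: algebra_simps)
  have "\<bar>k * inner (R - R') (\<delta>\<^sup>+ B)\<bar> \<le> k * (?A * (2 * norm B))"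
    using CS[of "R - R'" ?A B] k by (simp add: abs_mult)
  moreover have "\<bar>inner (?f - ?g) (\<delta>\<^sup>+ B)\<bar> \<le> L * ?A * (2 * norm B)" by (rule CS[OF fg])
  moreover have "k * (?A * (2 * norm B)) + L * ?A * (2 * norm B)
      \<le> 2 * (k + L) * (1 / k + 1) * E"
  proof -
    have "(k + L) * (2 * (?A * norm B)) \<le> (k + L) * (2 * (1 / k + 1) * E)"
      using AB k L(1) by (intro mult_left_mono) auto
    moreover have "(k + L) * (2 * (?A * norm B)) = k * (?A * (2 * norm B)) + L * ?A * (2 * norm B)"
      by (simp add: algebra_simps)
    moreover have "(k + L) * (2 * (1 / k + 1) * E) = 2 * (k + L) * (1 / k + 1) * E"
      by (simp only: ac_simps)
    ultimately show ?thesis by metis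
  qed
  moreover have "\<bar>\<mu> * inner ?g (\<delta>\<^sup>+ q)\<bar> \<le> \<mu> * (L * d)\<^sup>2 + 2 * E"
  proof -
    have "\<bar>\<mu> * inner ?g (\<delta>\<^sup>+ q)\<bar> \<le> \<mu> * (L * d * (2 * norm q))"
      using CS[OF g, of q] \<open>\<mu> > 0\<close> by (simp add: abs_mult)
    also have "\<dots> \<le> \<mu> * ((L * d)\<^sup>2 + (norm q)\<^sup>2)"
      using sum_squares_bound[of "L * d" "norm q"] \<open>\<mu> > 0\<close> by (intro mult_left_mono) auto
    finally show ?thesis using q2 by (simp add: distrib_left)
  qed
  ultimately show ?thesis unfolding distrib_right[of _ 2 E] by linarith
qed

theorem corollary3:
  fixes V :: "real \<Rightarrow> real" and k :: real
  assumes "smooth V" and "V 0 = 0" and "deriv V 0 = 0"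
    and "k = deriv (deriv V) 0" and "k > 0"
  shows "\<exists>\<rho>>0. \<forall>\<kappa>>0. \<forall>K>0. \<forall>T>0. \<exists>\<mu>\<^sub>0>0. \<exists>C>0. \<forall>\<mu>. 0 < \<mu> \<and> \<mu> \<le> \<mu>\<^sub>0 \<longrightarrow>
    (\<forall>R' P' R P r p.
      solves_FPUT V {-T..T} R' P' \<and>
      norm (R' 0) + norm (P' 0) \<le> \<rho> \<and>
      solves_MiM V \<kappa> \<mu> {-T..T} R P r p \<and>
      mu_norm k \<kappa> \<mu> ((R 0, P 0, r 0, p 0) - (R' 0, P' 0, 0, P' 0)) \<le> K * sqrt \<mu> \<longrightarrow>
      (\<forall>t\<in>{-T..T}.
        mu_norm k \<kappa> \<mu> ((R t, P t, r t, p t) - (R' t, P' t, 0, P' t)) \<le> C * sqrt \<mu>))"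
proof -
  note V = assms(1-3) and k = assms(5)
  have "\<exists>e>0. \<forall>x. dist x 0 < e \<longrightarrow> dist (deriv (deriv V) x) k < k / 2"
    using smooth_isCont_deriv2[OF V(1), of 0] k
    unfolding assms(4)[symmetric] continuous_at_eps_delta by (meson half_gt_zero)
  then obtain e where e: "e > 0" "\<And>x. \<bar>x\<bar> < e \<Longrightarrow> \<bar>deriv (deriv V) x - k\<bar> < k / 2"
    by (auto simp: dist_real_def)
  define d where "d = e / 2"
  have d: "d > 0" "\<And>x. \<bar>x\<bar> \<le> d \<Longrightarrow> k / 2 \<le> deriv (deriv V) x \<and> deriv (deriv V) x \<le> 2 * k"
  proof -
    show "d > 0" using e(1) by (simp add: d_def)
    fix x :: real assume "\<bar>x\<bar> \<le> d"
    then have "\<bar>deriv (deriv V) x - k\<bar> < k / 2" using e by (simp add: d_def)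
    then show "k / 2 \<le> deriv (deriv V) x \<and> deriv (deriv V) x \<le> 2 * k" using k by linarith
  qed
  obtain L where L: "L \<ge> 0" "\<And>x. \<bar>x\<bar> \<le> d + 1 \<Longrightarrow> \<bar>deriv (deriv V) x\<bar> \<le> L"
    using smooth_deriv2_bounded[OF V(1), of "d + 1"] by blast
  define a where "a = 2 * (k + L) * (1 / k + 1) + 2"
  have a: "a > 0" unfolding a_def using k L(1) by (intro add_nonneg_pos mult_nonneg_nonneg) auto
  show ?thesis
  proof (rule exI[of _ "d / 2 * sqrt (k / (2 + 4 * k))"], intro conjI allI impI)
    show "d / 2 * sqrt (k / (2 + 4 * k)) > 0" using d k by simp
    fix \<kappa> K T :: real assume \<kappa>: "\<kappa> > 0" and K: "K > 0" and T: "T > 0"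
    define c where "c = (K\<^sup>2 + (L * d)\<^sup>2 / a) * exp (a * T)"
    have c: "c > 0" unfolding c_def using K a by (intro mult_pos_pos add_pos_nonneg) auto
    show "\<exists>\<mu>\<^sub>0>0. \<exists>C>0. \<forall>\<mu>. 0 < \<mu> \<and> \<mu> \<le> \<mu>\<^sub>0 \<longrightarrow>
    (\<forall>R' P' R P r p.
      solves_FPUT V {-T..T} R' P' \<and>
      norm (R' 0) + norm (P' 0) \<le> d / 2 * sqrt (k / (2 + 4 * k)) \<and>
      solves_MiM V \<kappa> \<mu> {-T..T} R P r p \<and>
      mu_norm k \<kappa> \<mu> ((R 0, P 0, r 0, p 0) - (R' 0, P' 0, 0, P' 0)) \<le> K * sqrt \<mu> \<longrightarrow>
      (\<forall>t\<in>{-T..T}.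
        mu_norm k \<kappa> \<mu> ((R t, P t, r t, p t) - (R' t, P' t, 0, P' t)) \<le> C * sqrt \<mu>))"
    \<comment> \<open>Gronwall's bound will be \<open>c * \<mu>\<close>; the choice \<open>\<mu> \<le> k / (4 * c)\<close> keeps it at most \<open>k / 4\<close>, strictly
      below the level \<open>k / 2\<close> up to which the differential inequality holds.\<close>
    proof (rule exI[of _ "k / (4 * c)"], intro exI[of _ "sqrt c"] conjI allI impI ballI)
      show "k / (4 * c) > 0" "sqrt c > 0" using k c by auto
      fix \<mu> R' P' R P r p t
      assume \<mu>: "0 < \<mu> \<and> \<mu> \<le> k / (4 * c)" and t: "t \<in> {-T..T}"
      assume *: "solves_FPUT V {-T..T} R' P' \<and>
        norm (R' 0) + norm (P' 0) \<le> d / 2 * sqrt (k / (2 + 4 * k)) \<and>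
        solves_MiM V \<kappa> \<mu> {-T..T} R P r p \<and>
        mu_norm k \<kappa> \<mu> ((R 0, P 0, r 0, p 0) - (R' 0, P' 0, 0, P' 0)) \<le> K * sqrt \<mu>"
      then have F: "solves_FPUT V {-T..T} R' P'" and M: "solves_MiM V \<kappa> \<mu> {-T..T} R P r p"
        by blast+
      have R': "norm (R' s) \<le> d" if "s \<in> {-T..T}" for s
        using FPUT_small[OF V k d F that] * by blast
      define E where "E s = k / 2 * (norm (R s - R' s))\<^sup>2 + 1 / 2 * (norm (P s - P' s))\<^sup>2
        + \<kappa> / 2 * (norm (r s))\<^sup>2 + \<mu> / 2 * (norm (p s - P' s))\<^sup>2" for s
      have E_nonneg: "0 \<le> E s" for s using k \<kappa> \<mu> by (simp add: E_def)
      have norm_E: "mu_norm k \<kappa> \<mu> ((R s, P s, r s, p s) - (R' s, P' s, 0, P' s)) = sqrt (E s)" for s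
        by (simp add: mu_norm_def E_def)
      have "sqrt (E 0) \<le> K * sqrt \<mu>" using * norm_E by simp
      then have "(sqrt (E 0))\<^sup>2 \<le> (K * sqrt \<mu>)\<^sup>2" using E_nonneg by (intro power_mono) auto
      then have "E 0 \<le> K\<^sup>2 * \<mu>" using E_nonneg \<mu> by (simp add: power_mult_distrib)
      then have "(E 0 + \<mu> * (L * d)\<^sup>2 / a) * exp (a * T) \<le> (K\<^sup>2 * \<mu> + \<mu> * (L * d)\<^sup>2 / a) * exp (a * T)"
        by (intro mult_right_mono) auto
      also have "\<dots> = c * \<mu>" by (simp add: c_def algebra_simps)
      finally have init: "(E 0 + \<mu> * (L * d)\<^sup>2 / a) * exp (a * T) \<le> c * \<mu>" .
      have "c * \<mu> \<le> c * (k / (4 * c))" using \<mu> c by (intro mult_left_mono) auto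
      also have "\<dots> < k / 2" using c k by simp
      finally have barrier: "c * \<mu> < k / 2" .
      have "E t \<le> (E 0 + \<mu> * (L * d)\<^sup>2 / a) * exp (a * T)"
      proof (rule Gronwall_barrier[where M = "k / 2", OF _ _ a _ E_nonneg _ t])
        show "(E has_real_derivative
          (k * inner (R s - R' s) (\<delta>\<^sup>+ (P s - P' s))
          - inner (map_ell2 (deriv V) (R s) - map_ell2 (deriv V) (R' s)) (\<delta>\<^sup>+ (P s - P' s))
          + \<mu> * inner (map_ell2 (deriv V) (R' s)) (\<delta>\<^sup>+ (p s - P' s)))) (at s within {-T..T})"
          if "s \<in> {-T..T}" for s
          unfolding E_def by (rule error_energy_derivative[OF F M that])
        show "\<bar>k * inner (R s - R' s) (\<delta>\<^sup>+ (P s - P' s))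
          - inner (map_ell2 (deriv V) (R s) - map_ell2 (deriv V) (R' s)) (\<delta>\<^sup>+ (P s - P' s))
          + \<mu> * inner (map_ell2 (deriv V) (R' s)) (\<delta>\<^sup>+ (p s - P' s))\<bar> \<le> a * E s + \<mu> * (L * d)\<^sup>2"
          if "s \<in> {-T..T}" "E s \<le> k / 2" for s
          unfolding a_def
          by (rule error_energy_growth[OF V(1,3) k \<kappa> _ L R'[OF that(1)] E_def that(2)]) (use \<mu> in auto)
      qed (use \<mu> le_less_trans[OF init barrier] in auto)
      then have "E t \<le> c * \<mu>" using init by simp
      then show "mu_norm k \<kappa> \<mu> ((R t, P t, r t, p t) - (R' t, P' t, 0, P' t)) \<le> sqrt c * sqrt \<mu>"
        unfolding norm_E real_sqrt_mult[symmetric] by (rule real_sqrt_le_mono)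
    qed
  qed
qed

end
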